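(* (Taylor formula in $(\sigma,\tau)$-quantum calculus.) Let $M,\sigma,\tau,\theta,D$, the basis $\{\zeta_s\}_{s\in S}$ of $Z(D)$, the points $\{q_s\}_{s\in S}$, the functions $\Lambda_{q_ss}^{(k)}$, the spaces $V_s(D)$, the projections $\pi_s$ and the operators $R,F$ be as in the context. Let $n\in\mathbb N_0$ and let $W\in\ker D^{n+1}\setminus\ker D^{n}$, i.e. $W$ is a $D$-polynomial of degree $n$. For $k=0,\dots,n$ let $S_W^k\subset S$ be a finite subset such that $FD^kW=\sum_{s\in S_W^k}\lambda_{ks}\zeta_s$ with real coefficients $\lambda_{ks}$ (put $\lambda_{ks}=0$ for $s\notin S_W^k$), let $S_W=\bigcup_{k=0}^nS_W^k$, and put $W_s=\pi_s(W)$. Then $W=\sum_{s\in S_W}W_s$, the coefficients are $\lambda_{ks}=(D^kW_s)(q_s)$, and $$W_s=\sum_{k=0}^{n}(D^kW_s)(q_s)\,\Lambda_{q_ss}^{(k)}\qquad\text{for every } s\in S_W,$$ $$W=\sum_{s\in S_W}\sum_{k=0}^{n}(D^kW_s)(q_s)\,\Lambda_{q_ss}^{(k)}.$$ In particular, if $W\in V_s(D)$ for some $s\in S$, then $W=\sum_{k=0}^{n}(D^kW)(q_s)\,\Lambda_{q_ss}^{(k)}$.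
   Context: $\mathbb N=\{1,2,\dots\}$, $\mathbb N_0=\{0,1,2,\dots\}$. $M$ is a set. A tension function is a function $\theta:M\times M\to\mathbb R$ with $\theta(p_1,p_2)+\theta(p_2,p_3)=\theta(p_1,p_3)$ for all $p_1,p_2,p_3\in M$; write $\theta_q(p)=\theta(p,q)$. The maps $\sigma,\tau:M\to M$ commute, $\theta$ is a tension function with $\theta(\tau(p),\sigma(p))\ne0$ for all $p\in M$, and $\theta$ is homogeneous with respect to $\sigma$ and $\tau$: there are real numbers $s_0,t_0$ with $\theta(\sigma(p_1),\sigma(p_2))=s_0\,\theta(p_1,p_2)$ and $\theta(\tau(p_1),\tau(p_2))=t_0\,\theta(p_1,p_2)$ for all $p_1,p_2\in M$. The $(\sigma,\tau)$-quantum derivative $D$ acts on $X=\mathbb R^M$ by $Df(p)=\dfrac{f(\tau(p))-f(\sigma(p))}{\theta(\tau(p),\sigma(p))}$; $D^0$ is the identity. Put $[n]=\sum_{k=1}^{n}t_0^{\,n-k}s_0^{\,k-1}$ for $n\in\mathbb N$, $[0]!=1$, $[n]!=[n]\cdot[n-1]!$. For $q\in M$ define $\theta_q^{(0)}=1$ (constant function) and $\theta_q^{(m)}=\prod_{k=1}^{m}\theta_{\tau^{m-k}\sigma^{k-1}(q)}$ for $m\in\mathbb N$. Let $\{\zeta_s\}_{s\in S}$ be a basis of $Z(D)=\ker D$. With any such basis one associates a family of points $\{q_s\}_{s\in S}\subset M$ such that $\zeta_s(q_s)\neq0$ and $\zeta_{s_1}(q_{s_2})=0$ for $s_1\neq s_2$,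 and normalizes the basis so that $\zeta_s(q_s)=1$ and $\zeta_s(q_t)=0$ for $s\ne t$. Define $\zeta_{q_ss}^{(k)}=\frac1{[k]!}(\zeta_s\circ\sigma^{-k})\cdot\theta_{q_s}^{(k)}$ for $s\in S$, $k\in\mathbb N_0$ ($\sigma^{-k}$ being the $k$-th iterate of the inverse of $\sigma$), and recursively $\Lambda_{q_ss}^{(0)}=\zeta_s$, $$\Lambda_{q_ss}^{(m)}=\zeta_{q_ss}^{(m)}-\sum_{i=0}^{m-1}\zeta_{q_ss}^{(m-i)}(q_s)\,\Lambda_{q_ss}^{(i)},\qquad m\in\mathbb N.$$ For $m\in\mathbb N_0$, a $D$-polynomial of degree $m$ is an element of $\ker D^{m+1}\setminus\ker D^m$, and $P(D)=\bigcup_{k\ge0}\ker D^k$. Put $V_s(D)=\operatorname{Lin}\{\Lambda_{q_ss}^{(m)}:m\in\mathbb N_0\}$; one has $P(D)=\bigoplus_{s\in S}V_s(D)$, and $\pi_s:P(D)\to V_s(D)$ denotes the projection associated with this direct sum. $R$ is a right inverse of $D$ ($DR=I$) given on $P(D)$ by $R\Lambda_{q_ss}^{(m)}=\Lambda_{q_ss}^{(m+1)}$ for all $s\in S$, $m\in\mathbb N_0$ (and defined arbitrarily, as a right inverse, on a linear complement of $P(D)$ in $X$), and $F=I-RD$ is the corresponding initial operator, a projection onto $Z(D)$. *)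

theory Defs
  imports Complex_Main "HOL-Library.Function_Algebras"
begin

text \<open>The pointwise real vector space structure on functions, so that the library notions
  \<open>linear\<close>, \<open>span\<close> and \<open>independent\<close> apply to the space of real functions on \<open>M\<close>. The set \<open>M\<close>
  is rendered as the type \<open>'m\<close>.\<close>

instantiation "fun" :: (type, real_vector) real_vector
begin

definition scaleR_fun :: "real \<Rightarrow> ('a \<Rightarrow> 'b) \<Rightarrow> 'a \<Rightarrow> 'b"
  where "scaleR_fun c f = (\<lambda>x. c *\<^sub>R f x)"

instance
  by standard (simp_all add: scaleR_fun_def fun_eq_iff algebra_simps)

end

definition tension :: "('m \<Rightarrow> 'm \<Rightarrow> real) \<Rightarrow> bool" where
  "tension \<theta> \<longleftrightarrow> (\<forall>p1 p2 p3. \<theta> p1 p2 + \<theta> p2 p3 = \<theta> p1 p3)"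

definition homogeneous :: "('m \<Rightarrow> 'm \<Rightarrow> real) \<Rightarrow> ('m \<Rightarrow> 'm) \<Rightarrow> real \<Rightarrow> bool" where
  "homogeneous \<theta> \<sigma> c \<longleftrightarrow> (\<forall>p1 p2. \<theta> (\<sigma> p1) (\<sigma> p2) = c * \<theta> p1 p2)"

definition qderiv ::
  "('m \<Rightarrow> 'm) \<Rightarrow> ('m \<Rightarrow> 'm) \<Rightarrow> ('m \<Rightarrow> 'm \<Rightarrow> real) \<Rightarrow> ('m \<Rightarrow> real) \<Rightarrow> 'm \<Rightarrow> real" where
  "qderiv \<sigma> \<tau> \<theta> f p = (f (\<tau> p) - f (\<sigma> p)) / \<theta> (\<tau> p) (\<sigma> p)"

definition kernel :: "('a \<Rightarrow> 'b::zero) \<Rightarrow> 'a set" where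
  "kernel L = {f. L f = 0}"

definition qnum :: "real \<Rightarrow> real \<Rightarrow> nat \<Rightarrow> real" where
  "qnum s0 t0 n = (\<Sum>k=1..n. t0 ^ (n - k) * s0 ^ (k - 1))"

primrec qfact :: "real \<Rightarrow> real \<Rightarrow> nat \<Rightarrow> real" where
  "qfact s0 t0 0 = 1"
| "qfact s0 t0 (Suc n) = qnum s0 t0 (Suc n) * qfact s0 t0 n"

definition theta_pow ::
  "('m \<Rightarrow> 'm) \<Rightarrow> ('m \<Rightarrow> 'm) \<Rightarrow> ('m \<Rightarrow> 'm \<Rightarrow> real) \<Rightarrow> 'm \<Rightarrow> nat \<Rightarrow> 'm \<Rightarrow> real" where
  "theta_pow \<sigma> \<tau> \<theta> q m p = (\<Prod>k=1..m. \<theta> p ((\<tau> ^^ (m - k)) ((\<sigma> ^^ (k - 1)) q)))"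

text \<open>In the next two definitions \<open>z\<close> and \<open>q\<close> stand for a basis function \<open>\<zeta>\<^sub>s\<close> and its
  point \<open>q\<^sub>s\<close>. They are meaningful only if all \<open>qfact s0 t0 k\<close> are nonzero, as division by
  zero yields zero.\<close>

definition zeta_pow ::
  "('m \<Rightarrow> 'm) \<Rightarrow> ('m \<Rightarrow> 'm) \<Rightarrow> ('m \<Rightarrow> 'm \<Rightarrow> real) \<Rightarrow> real \<Rightarrow> real \<Rightarrow> ('m \<Rightarrow> real) \<Rightarrow> 'm
    \<Rightarrow> nat \<Rightarrow> 'm \<Rightarrow> real" where
  "zeta_pow \<sigma> \<tau> \<theta> s0 t0 z q k p =
     1 / qfact s0 t0 k * (z ((inv \<sigma> ^^ k) p) * theta_pow \<sigma> \<tau> \<theta> q k p)"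

fun Lambda ::
  "('m \<Rightarrow> 'm) \<Rightarrow> ('m \<Rightarrow> 'm) \<Rightarrow> ('m \<Rightarrow> 'm \<Rightarrow> real) \<Rightarrow> real \<Rightarrow> real \<Rightarrow> ('m \<Rightarrow> real) \<Rightarrow> 'm
    \<Rightarrow> nat \<Rightarrow> 'm \<Rightarrow> real" where
  "Lambda \<sigma> \<tau> \<theta> s0 t0 z q 0 = z"
| "Lambda \<sigma> \<tau> \<theta> s0 t0 z q (Suc m) =
     zeta_pow \<sigma> \<tau> \<theta> s0 t0 z q (Suc m)
     - (\<Sum>i=0..m. zeta_pow \<sigma> \<tau> \<theta> s0 t0 z q (Suc m - i) q *\<^sub>R Lambda \<sigma> \<tau> \<theta> s0 t0 z q i)"

definition basis_family :: "'s set \<Rightarrow> ('s \<Rightarrow> 'v::real_vector) \<Rightarrow> 'v set \<Rightarrow> bool" where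
  "basis_family S \<zeta> Z \<longleftrightarrow> inj_on \<zeta> S \<and> independent (\<zeta> ` S) \<and> span (\<zeta> ` S) = Z"

text \<open>The projection \<open>\<pi>\<^sub>s\<close> of \<open>\<Oplus>\<^sub>s V\<^sub>s\<close> onto \<open>V\<^sub>s\<close>: the \<open>s\<close>-entry of the unique finitely supported
  family \<open>u\<close> with \<open>u\<^sub>s \<in> V\<^sub>s\<close> that sums up to \<open>w\<close>. It is meaningful if the sum of the \<open>V\<^sub>s\<close> is
  direct and contains \<open>w\<close>.\<close>

definition direct_sum_proj ::
  "'s set \<Rightarrow> ('s \<Rightarrow> 'v::real_vector set) \<Rightarrow> 's \<Rightarrow> 'v \<Rightarrow> 'v" where
  "direct_sum_proj S V s w =
     (THE u. (\<forall>t\<in>S. u t \<in> V t) \<and> (\<forall>t. t \<notin> S \<longrightarrow> u t = 0) \<and>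
             finite {t \<in> S. u t \<noteq> 0} \<and> w = (\<Sum>t\<in>{t \<in> S. u t \<noteq> 0}. u t)) s"

definition right_inverse :: "('v::real_vector \<Rightarrow> 'v) \<Rightarrow> ('v \<Rightarrow> 'v) \<Rightarrow> bool" where
  "right_inverse D R \<longleftrightarrow> linear R \<and> (\<forall>f. D (R f) = f)"

definition initial_op :: "('v::real_vector \<Rightarrow> 'v) \<Rightarrow> ('v \<Rightarrow> 'v) \<Rightarrow> 'v \<Rightarrow> 'v" where
  "initial_op D R f = f - R (D f)"

end

theory Submission
  imports Defs
begin

text \<open>The recursion defining \<open>\<Lambda>\<^sub>s\<close> is a triangular normalization that makes \<open>\<Lambda>\<^sub>s\<^sup>(\<^sup>m\<^sup>)\<close> vanish at
  \<open>q\<^sub>s\<close> for \<open>m > 0\<close>, and \<open>DR = I\<close> turns \<open>R \<Lambda>\<^sub>s\<^sup>(\<^sup>m\<^sup>) = \<Lambda>\<^sub>s\<^sup>(\<^sup>m\<^sup>+\<^sup>1\<^sup>)\<close> into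
  \<open>D \<Lambda>\<^sub>s\<^sup>(\<^sup>m\<^sup>+\<^sup>1\<^sup>) = \<Lambda>\<^sub>s\<^sup>(\<^sup>m\<^sup>)\<close>. Hence the functionals \<open>u \<mapsto> (D\<^sup>k u)(q\<^sub>s)\<close> read off coefficients
  inside each \<open>V\<^sub>s\<close>, and the sum of the \<open>V\<^sub>s\<close> is direct, since the highest derivative of a
  vanishing combination is a combination of the \<open>\<zeta>\<^sub>s\<close>. Iterating \<open>I = F + RD\<close> gives
  \<open>W = \<Sum>\<^sub>k R\<^sup>k F D\<^sup>k W\<close>, which exhibits the components \<open>\<pi>\<^sub>s W\<close>.\<close>

section \<open>Linear algebra: iterated maps, direct sums and spans of sequences\<close>

lemma sum_fun_apply: "(\<Sum>i\<in>I. f i) x = (\<Sum>i\<in>I. f i x)"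
  by (induction I rule: infinite_finite_induct) auto

lemma linear_qderiv: "linear (qderiv \<sigma> \<tau> \<theta>)"
  by (rule linearI)
    (simp_all add: qderiv_def scaleR_fun_def fun_eq_iff add_diff_add add_divide_distrib
      flip: right_diff_distrib)

lemma linear_funpow:
  fixes L :: "'v::real_vector \<Rightarrow> 'v"
  assumes "linear L"
  shows "linear (L ^^ k)"
proof (induction k)
  case 0
  show ?case by (simp add: linear_id id_def[symmetric])
next
  case (Suc k)
  show ?case using linear_compose[OF Suc assms] by (simp add: comp_def)
qed

text \<open>By strong induction the summands with \<open>i > 0\<close> vanish at \<open>q\<close>;
  the one with \<open>i = 0\<close> has \<open>z q = 1\<close> and cancels the leading term.\<close>

lemma Lambda_Suc_at_point:
  assumes "z q = 1"
  shows "Lambda \<sigma> \<tau> \<theta> s0 t0 z q (Suc m) q = 0"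
proof (induction m rule: less_induct)
  case (less m)
  let ?z = "zeta_pow \<sigma> \<tau> \<theta> s0 t0 z q" and ?L = "Lambda \<sigma> \<tau> \<theta> s0 t0 z q"
  have "(\<Sum>i=0..m. ?z (Suc m - i) q * ?L i q) = (\<Sum>i=0..m. if i = 0 then ?z (Suc m) q else 0)"
  proof (rule sum.cong[OF refl])
    fix i assume i: "i \<in> {0..m}"
    show "?z (Suc m - i) q * ?L i q = (if i = 0 then ?z (Suc m) q else 0)"
    proof (cases i)
      case 0
      then show ?thesis using assms by simp
    next
      case (Suc j)
      then have "?L i q = 0" using less[of j] i by simp
      then show ?thesis using Suc by simp
    qed
  qed
  also have "\<dots> = ?z (Suc m) q"
    by simp
  finally show ?case
    by (simp add: sum_fun_apply scaleR_fun_def)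
qed

text \<open>Telescoping: split the remainder by \<open>v = F v + R (D v)\<close>, with F the initial
  operator and \<open>v = (D ^^ n) w\<close>, then apply \<open>R ^^ n\<close>.\<close>

lemma right_inverse_taylor:
  fixes D R :: "'v::real_vector \<Rightarrow> 'v"
  assumes "linear R"
  shows "w = (\<Sum>k<n. (R ^^ k) (initial_op D R ((D ^^ k) w))) + (R ^^ n) ((D ^^ n) w)"
proof (induction n)
  case 0
  show ?case by simp
next
  case (Suc n)
  interpret linear "R ^^ n" by (rule linear_funpow[OF assms])
  have "(R ^^ n) ((D ^^ n) w)
      = (R ^^ n) (initial_op D R ((D ^^ n) w)) + (R ^^ Suc n) ((D ^^ Suc n) w)"
    by (simp add: initial_op_def diff funpow_swap1)
  then show ?case
    using Suc by (simp add: add.assoc)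
qed

text \<open>Evaluates the definite description behind the projection. Directness is given as
  triviality of vanishing sums, so uniqueness comes from applying it to a difference of two
  decompositions.\<close>

lemma direct_sum_proj_eq:
  assumes subspace: "\<And>t. t \<in> S \<Longrightarrow> subspace (V t)"
    and direct: "\<And>d T. finite T \<Longrightarrow> T \<subseteq> S \<Longrightarrow> (\<And>t. t \<in> T \<Longrightarrow> d t \<in> V t) \<Longrightarrow>
      (\<Sum>t\<in>T. d t) = 0 \<Longrightarrow> \<forall>t\<in>T. d t = 0"
    and T: "finite T" "T \<subseteq> S"
    and u: "\<And>t. t \<in> T \<Longrightarrow> u t \<in> V t" "\<And>t. t \<notin> T \<Longrightarrow> u t = 0"
    and w: "w = (\<Sum>t\<in>T. u t)"
  shows "direct_sum_proj S V s w = u s"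
proof -
  let ?P = "\<lambda>u. (\<forall>t\<in>S. u t \<in> V t) \<and> (\<forall>t. t \<notin> S \<longrightarrow> u t = 0) \<and>
             finite {t \<in> S. u t \<noteq> 0} \<and> w = (\<Sum>t\<in>{t \<in> S. u t \<noteq> 0}. u t)"
  have supp: "{t \<in> S. u t \<noteq> 0} \<subseteq> T"
    using u(2) by auto
  have "?P u"
  proof (intro conjI)
    show "\<forall>t\<in>S. u t \<in> V t"
      using u subspace subspace_0 by metis
    show "\<forall>t. t \<notin> S \<longrightarrow> u t = 0"
      using u(2) T(2) by auto
    show "finite {t \<in> S. u t \<noteq> 0}"
      using supp T(1) finite_subset by blast
    show "w = (\<Sum>t\<in>{t \<in> S. u t \<noteq> 0}. u t)"
      unfolding w by (rule sum.mono_neutral_right) (use T supp in auto)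
  qed
  moreover have "v = u" if v: "?P v" for v
  proof
    \<comment> \<open>A common finite index set containing both supports, so that the two sums can
      be subtracted termwise.\<close>
    let ?T = "T \<union> {t \<in> S. v t \<noteq> 0}"
    have fin: "finite ?T" and sub: "?T \<subseteq> S"
      using T v by auto
    have "(\<Sum>t\<in>?T. v t) = w"
    proof -
      have "(\<Sum>t\<in>?T. v t) = (\<Sum>t\<in>{t \<in> S. v t \<noteq> 0}. v t)"
        by (rule sum.mono_neutral_right) (use fin sub in auto)
      also have "\<dots> = w" using v by simp
      finally show ?thesis .
    qed
    moreover have "(\<Sum>t\<in>?T. u t) = w"
      unfolding w by (rule sum.mono_neutral_right) (use fin u(2) in auto)
    ultimately have "(\<Sum>t\<in>?T. v t - u t) = 0"
      by (simp add: sum_subtractf)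
    moreover have "v t - u t \<in> V t" if "t \<in> ?T" for t
      using that sub v \<open>?P u\<close> subspace by (blast intro: subspace_diff)
    ultimately have eq: "\<forall>t\<in>?T. v t - u t = 0"
      using direct[OF fin sub, of "\<lambda>t. v t - u t"] by blast
    fix t
    show "v t = u t"
    proof (cases "t \<in> ?T")
      case True
      with eq show ?thesis by (metis eq_iff_diff_eq_0)
    next
      case False
      then have "v t = 0" using v by blast
      with False show ?thesis using u(2) by simp
    qed
  qed
  ultimately have "(THE u. ?P u) = u"
    by (rule the_equality)
  then show ?thesis
    by (simp add: direct_sum_proj_def)
qed

text \<open>Coefficients belong to indices rather than to vectors, so repeated values of
  \<open>b\<close> cause no trouble. Being zero from \<open>N\<close> on, they can be padded to any
  greater length.\<close>

lemma span_range_nat_sum: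
  fixes b :: "nat \<Rightarrow> 'v::real_vector"
  assumes "v \<in> span (range b)"
  obtains N c where "\<And>k. k \<ge> N \<Longrightarrow> c k = 0" "v = (\<Sum>k<N. c k *\<^sub>R b k)"
proof -
  have "\<exists>N c. (\<forall>k\<ge>N. c k = 0) \<and> v = (\<Sum>k<N. c k *\<^sub>R b k)"
    using assms
  proof (induction rule: span_induct_alt)
    case base
    show ?case by (intro exI[of _ 0] exI[of _ "\<lambda>_. 0"]) simp
  next
    case (step a x y)
    then obtain m N c where x: "x = b m" and c: "\<forall>k\<ge>N. c k = 0"
      and y: "y = (\<Sum>k<N. c k *\<^sub>R b k)" by auto
    let ?N = "max N (Suc m)" and ?c = "c(m := c m + a)"
    have "y = (\<Sum>k<?N. c k *\<^sub>R b k)"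
      unfolding y by (rule sum.mono_neutral_left) (use c in auto)
    moreover have "a *\<^sub>R x = (\<Sum>k<?N. (if k = m then a else 0) *\<^sub>R b k)"
      by (simp add: x if_distrib[of "\<lambda>r. r *\<^sub>R _"] less_max_iff_disj cong: if_cong)
    ultimately have "a *\<^sub>R x + y = (\<Sum>k<?N. ?c k *\<^sub>R b k)"
      by (simp add: sum.distrib[symmetric] algebra_simps)
        (rule sum.cong, auto simp: algebra_simps)
    moreover have "\<forall>k\<ge>?N. ?c k = 0"
      using c by auto
    ultimately show ?case by blast
  qed
  then show thesis using that by blast
qed

text \<open>Each \<open>\<Lambda> s\<close> is a chain that \<open>D\<close> lowers step by step to
  0. Only level 0 is prescribed at the other points \<open>q t\<close>; higher levels are controlled
  at their own point \<open>q s\<close> alone.\<close>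

locale taylor_system =
  fixes D :: "('m \<Rightarrow> real) \<Rightarrow> 'm \<Rightarrow> real"
    and S :: "'s set"
    and \<Lambda> :: "'s \<Rightarrow> nat \<Rightarrow> 'm \<Rightarrow> real"
    and q :: "'s \<Rightarrow> 'm"
  assumes linear_D: "linear D"
    and D_Lambda_0: "s \<in> S \<Longrightarrow> D (\<Lambda> s 0) = 0"
    and D_Lambda_Suc: "s \<in> S \<Longrightarrow> D (\<Lambda> s (Suc m)) = \<Lambda> s m"
    and Lambda_0_at_point: "s \<in> S \<Longrightarrow> t \<in> S \<Longrightarrow> \<Lambda> s 0 (q t) = (if s = t then 1 else 0)"
    and Lambda_Suc_vanish: "s \<in> S \<Longrightarrow> \<Lambda> s (Suc m) (q s) = 0"
begin

section \<open>Coefficient functionals and independence of the chains\<close>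

lemma funpow_D_Lambda:
  assumes "s \<in> S"
  shows "(D ^^ k) (\<Lambda> s m) = (if k \<le> m then \<Lambda> s (m - k) else 0)"
proof (induction k)
  case 0
  show ?case by simp
next
  case (Suc k)
  consider "k < m" | "k = m" | "k > m" by linarith
  then show ?case
  proof cases
    case 1
    then have "m - k = Suc (m - Suc k)" by simp
    with Suc 1 show ?thesis using D_Lambda_Suc[OF assms] by simp
  next
    case 2
    with Suc show ?thesis using D_Lambda_0[OF assms] by simp
  next
    case 3
    then have "(D ^^ Suc k) (\<Lambda> s m) = D 0" using Suc by (simp add: zero_fun_def)
    with 3 show ?thesis by (simp only: linear_0[OF linear_D]) simp
  qed
qed

text \<open>Biorthogonality within one chain: for \<open>k < m\<close> a positive level remains,
  which vanishes at \<open>q s\<close>; for \<open>k = m\<close> level 0 remains, with value 1; for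
  \<open>k > m\<close> the derivative is already 0.\<close>

lemma funpow_D_Lambda_at_point:
  assumes "s \<in> S"
  shows "(D ^^ k) (\<Lambda> s m) (q s) = (if k = m then 1 else 0)"
proof (cases "k < m")
  case True
  then have "m - k = Suc (m - Suc k)" by simp
  with True show ?thesis
    using Lambda_Suc_vanish[OF assms] by (simp add: funpow_D_Lambda[OF assms])
next
  case False
  then show ?thesis
    using Lambda_0_at_point[OF assms assms] by (simp add: funpow_D_Lambda[OF assms])
qed

lemma funpow_D_combination:
  "(D ^^ k) (\<Sum>i\<in>I. c i *\<^sub>R f i) = (\<Sum>i\<in>I. c i *\<^sub>R (D ^^ k) (f i))"
  using linear_funpow[OF linear_D, of k] by (simp add: linear_sum linear_scale)

lemma coefficient_at_point:
  assumes "s \<in> S" "finite I"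
  shows "(D ^^ k) (\<Sum>i\<in>I. c i *\<^sub>R \<Lambda> s i) (q s) = (if k \<in> I then c k else 0)"
  using assms unfolding funpow_D_combination
  by (simp add: sum_fun_apply scaleR_fun_def funpow_D_Lambda_at_point
      if_distrib[of "\<lambda>r. _ * r"] cong: if_cong)

text \<open>The functionals read off the coefficients of some finite expansion of \<open>u\<close>,
  and the kernel condition removes those above \<open>n\<close>.\<close>

lemma span_Lambda_taylor:
  assumes s: "s \<in> S" and u: "u \<in> span (range (\<Lambda> s))" and ker: "(D ^^ Suc n) u = 0"
  shows "u = (\<Sum>k=0..n. (D ^^ k) u (q s) *\<^sub>R \<Lambda> s k)"
proof -
  obtain N c where c: "\<And>k. k \<ge> N \<Longrightarrow> c k = 0" and u_eq: "u = (\<Sum>k<N. c k *\<^sub>R \<Lambda> s k)"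
    using span_range_nat_sum[OF u] by blast
  have coeff: "(D ^^ k) u (q s) = c k" for k
    unfolding u_eq using coefficient_at_point[OF s] c[of k] by auto
  have "c k = 0" if "k > n" for k
  proof -
    have "(D ^^ k) u = (D ^^ (k - Suc n)) ((D ^^ Suc n) u)"
      using that funpow_add[of "k - Suc n" "Suc n" D] by (simp del: funpow.simps)
    then have "(D ^^ k) u = 0"
      using ker linear_0[OF linear_funpow[OF linear_D]] by simp
    then show ?thesis using coeff[of k] by simp
  qed
  \<comment> \<open>The length \<open>N\<close> and the bound \<open>n\<close> are not comparable a
    priori, hence the passage through the intersection of the ranges.\<close>
  then have "u = (\<Sum>k\<in>{..<N} \<inter> {0..n}. c k *\<^sub>R \<Lambda> s k)"
    unfolding u_eq by (intro sum.mono_neutral_right) auto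
  also have "\<dots> = (\<Sum>k=0..n. c k *\<^sub>R \<Lambda> s k)"
    by (rule sum.mono_neutral_left) (use c in auto)
  finally show ?thesis
    unfolding coeff .
qed

text \<open>Evaluation at \<open>q r\<close> does not separate chains at higher levels. So
  \<open>D ^^ N\<close> is applied first: in a combination of length \<open>Suc N\<close> only the
  top terms survive, as level 0 functions, and these are separated by the points. Induction then
  handles the shorter combination.\<close>

lemma Lambda_independent:
  assumes T: "finite T" "T \<subseteq> S"
    and "(\<Sum>t\<in>T. \<Sum>k<N. c t k *\<^sub>R \<Lambda> t k) = 0" "t \<in> T" "k < N"
  shows "c t k = 0"
  using assms(3-)
proof (induction N arbitrary: t k)
  case 0
  then show ?case by simp
next
  case (Suc N)
  have top: "c r N = 0" if r: "r \<in> T" for r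
  proof -
    have "0 = (D ^^ N) (\<Sum>t\<in>T. \<Sum>k<Suc N. c t k *\<^sub>R \<Lambda> t k)"
      unfolding Suc.prems(1) linear_0[OF linear_funpow[OF linear_D]] ..
    also have "\<dots> = (\<Sum>t\<in>T. \<Sum>k<Suc N. c t k *\<^sub>R (D ^^ N) (\<Lambda> t k))"
      by (subst linear_sum[OF linear_funpow[OF linear_D]]) (simp only: funpow_D_combination)
    also have "\<dots> = (\<Sum>t\<in>T. c t N *\<^sub>R \<Lambda> t 0)"
      by (rule sum.cong[OF refl]) (use T(2) in \<open>auto simp: funpow_D_Lambda\<close>)
    finally have "0 = (\<Sum>t\<in>T. c t N *\<^sub>R \<Lambda> t 0) (q r)"
      by (metis zero_fun_apply)
    also have "\<dots> = (\<Sum>t\<in>T. if t = r then c t N else 0)"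
      unfolding sum_fun_apply scaleR_fun_def
      by (rule sum.cong[OF refl]) (use T(2) r in \<open>auto simp: Lambda_0_at_point subset_iff\<close>)
    finally show ?thesis using T(1) r by simp
  qed
  then have "(\<Sum>t\<in>T. \<Sum>k<N. c t k *\<^sub>R \<Lambda> t k) = 0"
    using Suc.prems(1) by (simp add: zero_fun_def)
  then show ?case
    using Suc.IH Suc.prems top by (cases "k = N") auto
qed

lemma span_Lambda_direct:
  assumes T: "finite T" "T \<subseteq> S"
    and d: "\<And>t. t \<in> T \<Longrightarrow> d t \<in> span (range (\<Lambda> t))"
    and sum_0: "(\<Sum>t\<in>T. d t) = 0"
  shows "\<forall>t\<in>T. d t = 0"
proof -
  have "\<forall>t\<in>T. \<exists>N c. (\<forall>k\<ge>N. c k = 0) \<and> d t = (\<Sum>k<N. c k *\<^sub>R \<Lambda> t k)"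
    using span_range_nat_sum[OF d] by metis
  then obtain N c where c: "\<And>t k. t \<in> T \<Longrightarrow> k \<ge> N t \<Longrightarrow> c t k = 0"
    and d_eq: "\<And>t. t \<in> T \<Longrightarrow> d t = (\<Sum>k<N t. c t k *\<^sub>R \<Lambda> t k)"
    by metis
  \<comment> \<open>The sum of the lengths bounds each of them and also makes sense for empty
    \<open>T\<close>.\<close>
  let ?N = "\<Sum>t\<in>T. N t"
  have d_eq': "d t = (\<Sum>k<?N. c t k *\<^sub>R \<Lambda> t k)" if t: "t \<in> T" for t
  proof -
    have "N t \<le> ?N" using T(1) t by (simp add: member_le_sum)
    then show ?thesis
      unfolding d_eq[OF t] by (intro sum.mono_neutral_left) (use c[OF t] in auto)
  qed
  then have "(\<Sum>t\<in>T. \<Sum>k<?N. c t k *\<^sub>R \<Lambda> t k) = 0"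
    using sum_0 by simp
  then have "c t k = 0" if "t \<in> T" "k < ?N" for t k
    using Lambda_independent[OF T] that by blast
  then show ?thesis using d_eq' by simp
qed

lemma direct_sum_proj_Lambda:
  assumes T: "finite T" "T \<subseteq> S" and "finite I"
    and w: "w = (\<Sum>t\<in>T. \<Sum>k\<in>I. c t k *\<^sub>R \<Lambda> t k)"
  shows "direct_sum_proj S (\<lambda>t. span (range (\<Lambda> t))) s w
    = (if s \<in> T then \<Sum>k\<in>I. c s k *\<^sub>R \<Lambda> s k else 0)"
proof (rule direct_sum_proj_eq[OF subspace_span span_Lambda_direct T])
  show "(if t \<in> T then \<Sum>k\<in>I. c t k *\<^sub>R \<Lambda> t k else 0) \<in> span (range (\<Lambda> t))" if "t \<in> T" for t
    using that by (simp add: span_sum span_scale span_base)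
qed (use w in auto)

end

section \<open>The Taylor formula for the quantum derivative\<close>

theorem mainTheorem2:
  fixes \<sigma> \<tau> :: "'m \<Rightarrow> 'm"
    and \<theta> :: "'m \<Rightarrow> 'm \<Rightarrow> real"
    and s0 t0 :: real
    and D R F :: "('m \<Rightarrow> real) \<Rightarrow> 'm \<Rightarrow> real"
    and S :: "'s set"
    and \<zeta> :: "'s \<Rightarrow> 'm \<Rightarrow> real"
    and q :: "'s \<Rightarrow> 'm"
    and \<Lambda> :: "'s \<Rightarrow> nat \<Rightarrow> 'm \<Rightarrow> real"
    and V :: "'s \<Rightarrow> ('m \<Rightarrow> real) set"
    and \<pi> :: "'s \<Rightarrow> ('m \<Rightarrow> real) \<Rightarrow> 'm \<Rightarrow> real"
    and n :: nat
    and W :: "'m \<Rightarrow> real"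
  assumes commute: "\<sigma> \<circ> \<tau> = \<tau> \<circ> \<sigma>"
    and bij: "bij \<sigma>"
    and tension: "tension \<theta>"
    and nonzero: "\<And>p. \<theta> (\<tau> p) (\<sigma> p) \<noteq> 0"
    and hom_\<sigma>: "homogeneous \<theta> \<sigma> s0"
    and hom_\<tau>: "homogeneous \<theta> \<tau> t0"
    and D_eq: "D = qderiv \<sigma> \<tau> \<theta>"
    and basis: "basis_family S \<zeta> (kernel D)"
    and normalized: "\<And>s. s \<in> S \<Longrightarrow> \<zeta> s (q s) = 1"
    and vanish: "\<And>s t. s \<in> S \<Longrightarrow> t \<in> S \<Longrightarrow> s \<noteq> t \<Longrightarrow> \<zeta> s (q t) = 0"
    and \<Lambda>_eq: "\<And>s m. \<Lambda> s m = Lambda \<sigma> \<tau> \<theta> s0 t0 (\<zeta> s) (q s) m"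
    and V_eq: "\<And>s. V s = span (range (\<Lambda> s))"
    and \<pi>_eq: "\<And>s. \<pi> s = direct_sum_proj S V s"
    and R_inv: "right_inverse D R"
    and R_\<Lambda>: "\<And>s m. s \<in> S \<Longrightarrow> R (\<Lambda> s m) = \<Lambda> s (m + 1)"
    and F_eq: "F = initial_op D R"
    and W: "W \<in> kernel (D ^^ (n + 1)) - kernel (D ^^ n)"
  shows
    "(\<forall>(SWk :: nat \<Rightarrow> 's set) (l :: nat \<Rightarrow> 's \<Rightarrow> real) SW.
        (\<forall>k\<le>n. SWk k \<subseteq> S \<and> finite (SWk k) \<and>
           F ((D ^^ k) W) = (\<Sum>s\<in>SWk k. l k s *\<^sub>R \<zeta> s) \<and>
           (\<forall>s\<in>S - SWk k. l k s = 0)) \<and>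
        SW = (\<Union>k\<le>n. SWk k)
        \<longrightarrow>
        W = (\<Sum>s\<in>SW. \<pi> s W) \<and>
        (\<forall>k\<le>n. \<forall>s\<in>S. l k s = (D ^^ k) (\<pi> s W) (q s)) \<and>
        (\<forall>s\<in>SW. \<pi> s W = (\<Sum>k=0..n. (D ^^ k) (\<pi> s W) (q s) *\<^sub>R \<Lambda> s k)) \<and>
        W = (\<Sum>s\<in>SW. \<Sum>k=0..n. (D ^^ k) (\<pi> s W) (q s) *\<^sub>R \<Lambda> s k))
     \<and> (\<forall>s\<in>S. W \<in> V s \<longrightarrow> W = (\<Sum>k=0..n. (D ^^ k) W (q s) *\<^sub>R \<Lambda> s k))"
proof -
  have lin: "linear D"
    unfolding D_eq by (rule linear_qderiv)
  have R: "linear R" "\<And>f. D (R f) = f"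
    using R_inv by (auto simp: right_inverse_def)
  have \<Lambda>_0: "\<Lambda> s 0 = \<zeta> s" for s
    by (simp add: \<Lambda>_eq)
  interpret taylor_system D S \<Lambda> q
  proof (rule taylor_system.intro[OF lin])
    fix s t m assume s: "s \<in> S"
    have "\<zeta> s \<in> kernel D"
      using basis s span_base[of "\<zeta> s" "\<zeta> ` S"] by (auto simp: basis_family_def)
    then show "D (\<Lambda> s 0) = 0"
      by (simp add: \<Lambda>_0 kernel_def)
    show "D (\<Lambda> s (Suc m)) = \<Lambda> s m"
      using R(2)[of "\<Lambda> s m"] R_\<Lambda>[OF s] by simp
    show "\<Lambda> s (Suc m) (q s) = 0"
      using Lambda_Suc_at_point[where z = "\<zeta> s"] normalized[OF s] by (simp only: \<Lambda>_eq)
    show "\<Lambda> s 0 (q t) = (if s = t then 1 else 0)" if "t \<in> S"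
      using normalized[OF s] vanish[OF s that] by (auto simp: \<Lambda>_0)
  qed
  have ker: "(D ^^ Suc n) W = 0"
    using W by (simp add: kernel_def del: funpow.simps)
  have R_pow: "(R ^^ k) (\<zeta> s) = \<Lambda> s k" if "s \<in> S" for s k
    by (induction k) (simp_all add: \<Lambda>_0 R_\<Lambda>[OF that])
  have V: "V = (\<lambda>s. span (range (\<Lambda> s)))"
    using V_eq by auto
  show ?thesis
  proof (intro conjI allI impI ballI)
    \<comment> \<open>Within a single \<open>V s\<close> the expansion needs no projection.\<close>
    fix s assume "s \<in> S" "W \<in> V s"
    then show "W = (\<Sum>k=0..n. (D ^^ k) W (q s) *\<^sub>R \<Lambda> s k)"
      using span_Lambda_taylor ker V by blast
  next
    fix SWk :: "nat \<Rightarrow> 's set" and l :: "nat \<Rightarrow> 's \<Rightarrow> real" and SW :: "'s set"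
    assume "(\<forall>k\<le>n. SWk k \<subseteq> S \<and> finite (SWk k) \<and>
           F ((D ^^ k) W) = (\<Sum>s\<in>SWk k. l k s *\<^sub>R \<zeta> s) \<and>
           (\<forall>s\<in>S - SWk k. l k s = 0)) \<and> SW = (\<Union>k\<le>n. SWk k)"
    then have SWk: "\<And>k. k \<le> n \<Longrightarrow> SWk k \<subseteq> S" "\<And>k. k \<le> n \<Longrightarrow> finite (SWk k)"
      and FD: "\<And>k. k \<le> n \<Longrightarrow> F ((D ^^ k) W) = (\<Sum>s\<in>SWk k. l k s *\<^sub>R \<zeta> s)"
      and l_0: "\<And>k s. k \<le> n \<Longrightarrow> s \<in> S \<Longrightarrow> s \<notin> SWk k \<Longrightarrow> l k s = 0"
      and SW: "SW = (\<Union>k\<le>n. SWk k)"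
      by auto
    have SW_S: "SW \<subseteq> S" and fin: "finite SW"
      using SW SWk by auto
    \<comment> \<open>The remainder \<open>(R ^^ Suc n) ((D ^^ Suc n) W)\<close> is 0 because
      \<open>W\<close> lies in the kernel of \<open>D ^^ Suc n\<close>.\<close>
    have "W = (\<Sum>k<Suc n. (R ^^ k) (F ((D ^^ k) W)))"
      using right_inverse_taylor[OF R(1), of W D "Suc n"] ker linear_0[OF linear_funpow[OF R(1)]]
      by (simp add: F_eq del: funpow.simps sum.lessThan_Suc)
    also have "\<dots> = (\<Sum>k=0..n. \<Sum>s\<in>SW. l k s *\<^sub>R \<Lambda> s k)"
    proof (rule sum.cong)
      fix k assume "k \<in> {0..n}"
      then have k: "k \<le> n" by simp
      have "(R ^^ k) (F ((D ^^ k) W)) = (\<Sum>s\<in>SWk k. l k s *\<^sub>R (R ^^ k) (\<zeta> s))"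
        using linear_funpow[OF R(1), of k] by (simp add: FD[OF k] linear_sum linear_scale)
      also have "\<dots> = (\<Sum>s\<in>SWk k. l k s *\<^sub>R \<Lambda> s k)"
        by (rule sum.cong) (use SWk(1)[OF k] R_pow in auto)
      \<comment> \<open>Enlarging the index set to \<open>SW\<close>, independent of
        \<open>k\<close>, adds only zero coefficients and allows the two sums to be
        exchanged.\<close>
      also have "\<dots> = (\<Sum>s\<in>SW. l k s *\<^sub>R \<Lambda> s k)"
        by (rule sum.mono_neutral_left) (use fin SW SW_S k l_0 in auto)
      finally show "(R ^^ k) (F ((D ^^ k) W)) = (\<Sum>s\<in>SW. l k s *\<^sub>R \<Lambda> s k)" .
    qed auto
    finally have W_sum: "W = (\<Sum>s\<in>SW. \<Sum>k=0..n. l k s *\<^sub>R \<Lambda> s k)"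
      by (subst (asm) sum.swap)
    \<comment> \<open>\<open>W_sum\<close> groups \<open>W\<close> into elements of the
      \<open>V s\<close>, so uniqueness of the decomposition identifies the groups as the
      projections.\<close>
    have \<pi>: "\<pi> s W = (if s \<in> SW then \<Sum>k=0..n. l k s *\<^sub>R \<Lambda> s k else 0)" for s
      unfolding \<pi>_eq V
      by (rule direct_sum_proj_Lambda[OF fin SW_S _ W_sum]) simp
    have coeff: "l k s = (D ^^ k) (\<pi> s W) (q s)" if k: "k \<le> n" and s: "s \<in> S" for k s
    proof (cases "s \<in> SW")
      case True
      then show ?thesis
        using coefficient_at_point[OF s, of "{0..n}"] k by (simp add: \<pi>)
    next
      \<comment> \<open>Outside \<open>SW\<close> both sides are 0: the coefficient by convention,
        the derivative because \<open>\<pi> s W = 0\<close>.\<close>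
      case False
      then have "l k s = 0" using l_0 k s SW by blast
      with False show ?thesis
        using linear_0[OF linear_funpow[OF lin]] by (simp add: \<pi>)
    qed
    show \<pi>_taylor: "\<pi> s W = (\<Sum>k=0..n. (D ^^ k) (\<pi> s W) (q s) *\<^sub>R \<Lambda> s k)" if s: "s \<in> SW" for s
    proof -
      have "\<pi> s W = (\<Sum>k=0..n. l k s *\<^sub>R \<Lambda> s k)"
        using s by (simp add: \<pi>)
      also have "\<dots> = (\<Sum>k=0..n. (D ^^ k) (\<pi> s W) (q s) *\<^sub>R \<Lambda> s k)"
        by (rule sum.cong) (use coeff s SW_S in auto)
      finally show ?thesis .
    qed
    have "W = (\<Sum>s\<in>SW. \<Sum>k=0..n. l k s *\<^sub>R \<Lambda> s k)"
      by (rule W_sum)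
    also have "\<dots> = (\<Sum>s\<in>SW. \<pi> s W)"
      by (rule sum.cong) (auto simp: \<pi>)
    finally show W_\<pi>: "W = (\<Sum>s\<in>SW. \<pi> s W)" .
    also have "\<dots> = (\<Sum>s\<in>SW. \<Sum>k=0..n. (D ^^ k) (\<pi> s W) (q s) *\<^sub>R \<Lambda> s k)"
      by (rule sum.cong[OF refl \<pi>_taylor])
    finally show "W = (\<Sum>s\<in>SW. \<Sum>k=0..n. (D ^^ k) (\<pi> s W) (q s) *\<^sub>R \<Lambda> s k)" .
    show "l k s = (D ^^ k) (\<pi> s W) (q s)" if "k \<le> n" "s \<in> S" for k s
      using coeff that .
  qed
qed

end
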